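(* There is an absolute constant $C>0$ such that the following holds. Suppose $\Omega\subset\mathbb{R}^2$ is a simple polygon and let $\epsilon$ be the maximum side-length of a square (two-dimensional cube) contained in $\Omega$. Then $$\frac{|\partial\Omega|}{|\Omega|}\ge C\,\epsilon^{-1}.$$
   Context: A simple polygon is the compact region of the plane bounded by a simple closed polygonal curve. $|\partial\Omega|$ denotes the length of the boundary of $\Omega$ and $|\Omega|$ its area. Squares are axis-parallel. *)

theory Defs
  imports "HOL-Analysis.Analysis"
begin

text \<open>
  A closed polygonal curve is given by the list of its successive vertices, with the initial vertex
  repeated at the end; a triangle is thus \<open>[a, b, c, a]\<close>.
\<close>

fun polygonal_path :: "(real^2) list \<Rightarrow> real \<Rightarrow> real^2" where
  "polygonal_path [] = linepath 0 0"
| "polygonal_path [a] = linepath a a"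
| "polygonal_path [a, b] = linepath a b"
| "polygonal_path (a # b # c # vs) = linepath a b +++ polygonal_path (b # c # vs)"

fun polygonal_length :: "(real^2) list \<Rightarrow> real" where
  "polygonal_length (a # b # vs) = dist a b + polygonal_length (b # vs)"
| "polygonal_length _ = 0"

text \<open>
  A simple closed curve of this form has at least three distinct vertices, no repeated consecutive
  vertices, and traverses no edge twice.  Hence \<^const>\<open>polygonal_length\<close> is the length of its image.
\<close>

definition simple_closed_polygonal :: "(real^2) list \<Rightarrow> bool" where
  "simple_closed_polygonal vs \<longleftrightarrow>
     simple_path (polygonal_path vs) \<and> pathfinish (polygonal_path vs) = pathstart (polygonal_path vs)"

definition simple_polygon_with_boundary :: "(real^2) set \<Rightarrow> (real^2) list \<Rightarrow> bool" where
  "simple_polygon_with_boundary \<Omega> vs \<longleftrightarrow>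
     simple_closed_polygonal vs \<and>
     \<Omega> = path_image (polygonal_path vs) \<union> inside (path_image (polygonal_path vs))"

definition is_square :: "real \<Rightarrow> (real^2) set \<Rightarrow> bool" where
  "is_square s Q \<longleftrightarrow> s > 0 \<and> (\<exists>a. Q = cbox a (a + vec s))"

definition max_square_side :: "(real^2) set \<Rightarrow> real" where
  "max_square_side \<Omega> = (GREATEST s. \<exists>Q. is_square s Q \<and> Q \<subseteq> \<Omega>)"

end

theory Submission
  imports Defs
begin

text \<open>
  Let \<open>\<epsilon>\<close> be the largest side of a square in \<open>\<Omega>\<close> and \<open>L\<close> the length of the boundary.  The square of
  side \<open>2\<epsilon>\<close> centred at a point \<open>x\<close> of \<open>\<Omega>\<close> is too large to lie in \<open>\<Omega>\<close>; being connected, it meets the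
  boundary (\<open>connected_meets_boundary\<close>).  So \<open>\<Omega>\<close> lies in the neighbourhood of radius \<open>\<epsilon>\<close> of the boundary
  in the maximum norm, and what remains is to bound the area of \<open>\<Omega>\<close> by a multiple of \<open>\<epsilon> L\<close>.

  Walking along the boundary at unit speed and marking a point whenever the distance walked is a
  multiple of \<open>\<epsilon>\<close> gives at most \<open>L / \<epsilon> + 1\<close> points, and the squares of side \<open>4\<epsilon>\<close> around them cover
  the neighbourhood.  Hence the area is at most \<open>16 \<epsilon> (L + \<epsilon>)\<close> (\<open>measure_near_lipschitz_curve_le\<close>).
  The term \<open>\<epsilon>\<^sup>2\<close> is absorbed by \<open>\<epsilon> L\<close>: \<open>\<Omega>\<close> lies in a disc of radius \<open>L\<close> around a boundary point and
  contains a square of side \<open>\<epsilon>\<close>, so \<open>\<epsilon> \<le> 2 L\<close>.  This gives the constant \<open>1 / 48\<close>.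

  Two facts make the quotients meaningful.  The maximum \<open>\<epsilon>\<close> is attained because the admissible pairs
  of a corner and a side form a compact set (\<open>max_square_side_attained\<close>), and both \<open>\<epsilon>\<close> and the area
  are positive because of the Jordan curve theorem (\<open>inside_simple_closed_curve_nonempty\<close>).
\<close>

section \<open>Unit-speed parametrization of polygonal curves\<close>

lemma pathstart_polygonal_path: "pathstart (polygonal_path (a # vs)) = a"
  by (induction "a # vs" rule: polygonal_path.induct) auto

lemma path_image_polygonal_path_Cons:
  "path_image (polygonal_path (a # b # vs))
     = closed_segment a b \<union> path_image (polygonal_path (b # vs))"
proof (cases vs)
  case (Cons c ws)
  have "pathfinish (linepath a b) = pathstart (polygonal_path (b # vs))"
    by (simp add: pathstart_polygonal_path)
  then show ?thesis
    using Cons by (simp add: path_image_join)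
qed auto

lemma polygonal_length_nonneg: "0 \<le> polygonal_length vs"
  by (induction vs rule: polygonal_length.induct) auto

lemma unit_speed_segment:
  fixes a b :: "'a::real_normed_vector"
  shows "\<exists>e. 1-lipschitz_on {0..dist a b} e \<and> e 0 = a \<and> e (dist a b) = b
           \<and> closed_segment a b \<subseteq> e ` {0..dist a b}"
proof -
  define l where "l = dist a b"
  \<comment> \<open>For \<open>a = b\<close> the coefficient \<open>t / 0\<close> is \<open>0\<close> and the path is constant.\<close>
  define e where "e = (\<lambda>t. a + (t / l) *\<^sub>R (b - a))"
  have l: "0 \<le> l" "norm (b - a) = l"
    by (simp_all add: l_def dist_norm norm_minus_commute)
  have "1-lipschitz_on {0..l} e"
  proof (rule lipschitz_onI)
    fix s t :: real
    have "dist (e s) (e t) = norm ((s / l - t / l) *\<^sub>R (b - a))"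
      by (simp add: e_def dist_norm scaleR_left_diff_distrib)
    also have "\<dots> = \<bar>s / l - t / l\<bar> * l"
      by (simp add: l)
    also have "\<dots> \<le> 1 * dist s t"
      using l by (cases "l = 0") (auto simp: dist_real_def simp flip: diff_divide_distrib)
    finally show "dist (e s) (e t) \<le> 1 * dist s t" .
  qed simp
  moreover have "e l = b"
    using l by (cases "l = 0") (auto simp: e_def)
  moreover have "closed_segment a b \<subseteq> e ` {0..l}"
  proof
    fix x assume "x \<in> closed_segment a b"
    then obtain u where u: "0 \<le> u" "u \<le> 1" "x = a + u *\<^sub>R (b - a)"
      by (auto simp: in_segment algebra_simps)
    have "x = e (u * l)"
      using l u(3) by (cases "l = 0") (auto simp: e_def)
    moreover have "u * l \<in> {0..l}"
      using u l by (auto simp: mult_left_le_one_le)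
    ultimately show "x \<in> e ` {0..l}"
      by blast
  qed
  ultimately show ?thesis
    unfolding l_def[symmetric] by (intro exI[of _ e]) (auto simp: e_def)
qed

text \<open>
  The parametrization by arc length: the unit-speed paths of the edges are run one after the other.
  Its Lipschitz bound says that the curve cannot move away from a point faster than length is consumed.
\<close>

lemma unit_speed_polygonal_path:
  "\<exists>g. 1-lipschitz_on {0..polygonal_length vs} g \<and> g 0 = pathstart (polygonal_path vs)
     \<and> path_image (polygonal_path vs) \<subseteq> g ` {0..polygonal_length vs}"
proof (induction vs rule: polygonal_length.induct)
  case (1 a b vs)
  define l where "l = dist a b"
  define L where "L = polygonal_length (b # vs)"
  from 1 obtain g where g: "1-lipschitz_on {0..L} g" "g 0 = b"
    "path_image (polygonal_path (b # vs)) \<subseteq> g ` {0..L}"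
    unfolding L_def pathstart_polygonal_path by blast
  from unit_speed_segment[of a b] obtain e where e: "1-lipschitz_on {0..l} e" "e 0 = a" "e l = b"
    "closed_segment a b \<subseteq> e ` {0..l}"
    unfolding l_def by blast
  have nonneg: "0 \<le> l" "0 \<le> L"
    by (simp_all add: l_def L_def polygonal_length_nonneg)
  define h where "h = (\<lambda>t. if t \<le> l then e t else g (t - l))"
  have "1-lipschitz_on {l..l + L} (\<lambda>t. g (t - l))"
  proof (rule lipschitz_onI)
    fix x y assume "x \<in> {l..l + L}" "y \<in> {l..l + L}"
    then show "dist (g (x - l)) (g (y - l)) \<le> 1 * dist x y"
      using lipschitz_onD[OF g(1), of "x - l" "y - l"] by (simp add: dist_real_def)
  qed simp
  then have lip: "1-lipschitz_on {0..l + L} h"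
    unfolding h_def using e g by (intro lipschitz_on_concat) auto
  have "closed_segment a b \<subseteq> h ` {0..l + L}"
    using e(4) nonneg by (force simp: h_def)
  moreover have "g t \<in> h ` {0..l + L}" if "t \<in> {0..L}" for t
  proof
    show "g t = h (t + l)"
      using that e(3) g(2) by (cases "t = 0") (auto simp: h_def)
  qed (use that nonneg in auto)
  ultimately have "path_image (polygonal_path (a # b # vs)) \<subseteq> h ` {0..l + L}"
    unfolding path_image_polygonal_path_Cons using g(3) by blast
  moreover have "h 0 = a"
    using e nonneg by (simp add: h_def)
  ultimately show ?case
    using lip by (auto simp: pathstart_polygonal_path l_def L_def)
next
  case "2_1"
  show ?case
    by (intro exI[of _ "\<lambda>_. 0"]) (auto simp: lipschitz_on_def pathstart_def linepath_def)
next
  case ("2_2" v)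
  show ?case
    by (intro exI[of _ "\<lambda>_. v"]) (auto simp: lipschitz_on_def pathstart_def linepath_def)
qed

section \<open>The region enclosed by a simple closed curve\<close>

text \<open>
  The Jordan curve theorem is about curves in the complex plane; a linear isometry between
  \<open>\<real>\<^sup>2\<close> and the complex plane carries bounded complementary components to bounded complementary
  components.
\<close>

lemma inside_simple_closed_curve_nonempty:
  fixes c :: "real \<Rightarrow> real^2"
  assumes "simple_path c" "pathfinish c = pathstart c"
  shows "inside (path_image c) \<noteq> {}"
proof -
  have "DIM(real^2) = DIM(complex)"
    by simp
  then obtain f :: "real^2 \<Rightarrow> complex" and g where fg: "linear f" "linear g"
    "\<And>x. g (f x) = x" "\<And>y. f (g y) = y"
    by (rule isomorphisms_UNIV_UNIV) blast
  have "inj f"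
    by (metis fg(3) injI)
  then have "simple_path (f \<circ> c)"
    using assms fg by (simp add: simple_path_linear_image_eq)
  moreover have "pathfinish (f \<circ> c) = pathstart (f \<circ> c)"
    using assms by (simp add: pathfinish_def pathstart_def)
  ultimately obtain z where z: "z \<in> inside (path_image (f \<circ> c))"
    using Jordan_inside_outside by blast
  define T where "T = connected_component_set (- path_image c) (g z)"
  have "z \<notin> path_image (f \<circ> c)"
    using z by (simp add: inside_def)
  then have gz: "g z \<notin> path_image c"
    by (metis fg(4) image_eqI path_image_compose)
  have "f ` T \<subseteq> connected_component_set (- path_image (f \<circ> c)) z"
  proof (rule connected_component_maximal)
    show "z \<in> f ` T"
      using gz fg(4) by (metis ComplI T_def connected_component_refl_eq image_eqI mem_Collect_eq)
    show "connected (f ` T)"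
      unfolding T_def by (intro connected_linear_image fg connected_connected_component)
    have "T \<subseteq> - path_image c"
      unfolding T_def by (rule connected_component_subset)
    then show "f ` T \<subseteq> - path_image (f \<circ> c)"
      using \<open>inj f\<close> by (auto simp: path_image_compose inj_eq)
  qed
  then have "bounded (f ` T)"
    using z bounded_subset by (auto simp: inside_def)
  then have "bounded (g ` f ` T)"
    using fg(2) bounded_linear_image linear_linear by blast
  moreover have "g ` f ` T = T"
    by (simp add: image_image fg(3))
  ultimately have "g z \<in> inside (path_image c)"
    using gz by (simp add: inside_def T_def)
  then show ?thesis
    by blast
qed

text \<open>
  A connected set disjoint from \<open>S\<close> stays in one component of the complement, and \<open>inside S\<close> is a
  union of such components.
\<close>

lemma connected_meets_boundary:
  assumes "connected T" "x \<in> T" "x \<in> S \<union> inside S" "\<not> T \<subseteq> S \<union> inside S"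
  shows "T \<inter> S \<noteq> {}"
proof
  assume "T \<inter> S = {}"
  then have "T \<subseteq> - S" "x \<in> inside S"
    using assms by auto
  then have "T \<subseteq> inside S"
    using assms by (meson connected_component_def inside_same_component subsetI)
  then show False
    using assms by blast
qed

section \<open>Area near a curve of given length\<close>

definition square_around :: "real^2 \<Rightarrow> real \<Rightarrow> (real^2) set" where
  "square_around a r = cbox (a - vec r) (a + vec r)"

lemma mem_square_around: "x \<in> square_around a r \<longleftrightarrow> (\<forall>i. \<bar>x $ i - a $ i\<bar> \<le> r)"
  by (auto simp: square_around_def mem_box_cart abs_le_iff algebra_simps)

lemma measure_square_around:
  assumes "0 \<le> r"
  shows "measure lebesgue (square_around a r) = 4 * r\<^sup>2"
proof -
  have "a \<in> square_around a r"
    using assms by (simp add: mem_square_around)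
  then show ?thesis
    unfolding square_around_def
    by (subst measure_completion) (auto simp: content_cbox_if_cart UNIV_2 power2_eq_square)
qed

lemma is_square_square_around: "0 < r \<Longrightarrow> is_square (2 * r) (square_around a r)"
  unfolding is_square_def square_around_def
  by (intro conjI exI[of _ "a - vec r"]) (auto simp: vec_eq_iff intro!: arg_cong2[of _ _ _ _ cbox])

text \<open>
  The points \<open>g (k r)\<close> with \<open>k \<le> L / r\<close> serve as marks.  In the maximum norm, a
  point within \<open>r\<close> of \<open>g t\<close> is within \<open>2 r\<close> of the last mark before \<open>t\<close>, so it lies in the square of area \<open>16 r\<^sup>2\<close> around that mark.
\<close>

lemma measure_near_lipschitz_curve_le:
  fixes g :: "real \<Rightarrow> real^2"
  assumes g: "1-lipschitz_on {0..L} g" and "0 \<le> L" "0 < r" and A: "A \<in> sets lebesgue"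
    and near: "\<And>x. x \<in> A \<Longrightarrow> \<exists>t\<in>{0..L}. x \<in> square_around (g t) r"
  shows "measure lebesgue A \<le> 16 * r * (L + r)"
proof -
  define N where "N = nat \<lfloor>L / r\<rfloor>"
  define B where "B = (\<lambda>k::nat. square_around (g (real k * r)) (2 * r))"
  have B: "B k \<in> lmeasurable" for k
    unfolding B_def square_around_def by (rule lmeasurable_cbox)
  have "A \<subseteq> (\<Union>k\<in>{..N}. B k)"
  proof
    fix x assume "x \<in> A"
    from near[OF this] obtain t where "t \<in> {0..L}" and x: "x \<in> square_around (g t) r"
      by blast
    then have t: "0 \<le> t" "t \<le> L"
      by auto
    define k where "k = nat \<lfloor>t / r\<rfloor>"
    have "t / r \<le> L / r"
      using t \<open>0 < r\<close> by (simp add: divide_right_mono)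
    then have "k \<le> N"
      unfolding k_def N_def by (intro nat_mono floor_mono)
    have "0 \<le> t / r"
      using t \<open>0 < r\<close> by simp
    then have "real k \<le> t / r" "t / r \<le> real k + 1"
      unfolding k_def by linarith+
    then have k: "real k * r \<le> t" "t \<le> real k * r + r"
      using \<open>0 < r\<close> by (simp_all add: field_simps)
    have "dist (g t) (g (real k * r)) \<le> dist t (real k * r)"
      using lipschitz_onD[OF g, of t "real k * r"] t k \<open>0 < r\<close> by auto
    also have "\<dots> \<le> r"
      using k by (simp add: dist_real_def)
    finally have "\<bar>g t $ i - g (real k * r) $ i\<bar> \<le> r" for i
      using component_le_norm_cart[of "g t - g (real k * r)" i] by (simp add: dist_norm)
    moreover have "\<bar>x $ i - g t $ i\<bar> \<le> r" for i
      using x by (simp add: mem_square_around)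
    ultimately have "\<bar>(x $ i - g t $ i) + (g t $ i - g (real k * r) $ i)\<bar> \<le> r + r" for i
      by (intro order_trans[OF abs_triangle_ineq] add_mono)
    then have "\<bar>x $ i - g (real k * r) $ i\<bar> \<le> 2 * r" for i
      by simp
    then have "x \<in> B k"
      by (simp add: B_def mem_square_around)
    then show "x \<in> (\<Union>k\<in>{..N}. B k)"
      using \<open>k \<le> N\<close> by blast
  qed
  then have "measure lebesgue A \<le> measure lebesgue (\<Union>k\<in>{..N}. B k)"
    using A B by (intro measure_mono_fmeasurable fmeasurable.finite_UN) auto
  also have "\<dots> \<le> (\<Sum>k\<le>N. measure lebesgue (B k))"
    using B by (intro measure_UNION_le) auto
  also have "\<dots> = (real N + 1) * (16 * r\<^sup>2)"
    using \<open>0 < r\<close> by (simp add: B_def measure_square_around)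
  also have "\<dots> \<le> (L / r + 1) * (16 * r\<^sup>2)"
  proof -
    have "0 \<le> L / r"
      using assms by simp
    then have "real N \<le> L / r"
      unfolding N_def by linarith
    then show ?thesis
      by (intro mult_right_mono) auto
  qed
  also have "\<dots> = 16 * r * (L + r)"
    using \<open>0 < r\<close> by (simp add: field_simps power2_eq_square)
  finally show ?thesis .
qed

section \<open>The largest square in a compact set\<close>

lemma cbox_vec_eq_image:
  fixes a :: "real^'n"
  assumes "0 \<le> s"
  shows "cbox a (a + vec s) = (\<lambda>u. a + s *\<^sub>R u) ` cbox 0 (vec 1)"
proof (intro equalityI subsetI)
  fix x assume x: "x \<in> cbox a (a + vec s)"
  show "x \<in> (\<lambda>u. a + s *\<^sub>R u) ` cbox 0 (vec 1)"
  proof (cases "s = 0")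
    case True
    then have "x = a"
      using x by (auto simp: mem_box_cart vec_eq_iff intro: antisym)
    then show ?thesis
      using True by (auto simp: mem_box_cart intro!: image_eqI[of _ _ 0])
  next
    case False
    then have "x = a + s *\<^sub>R ((1 / s) *\<^sub>R (x - a))"
      by simp
    moreover have "(1 / s) *\<^sub>R (x - a) \<in> cbox 0 (vec 1)"
      using x assms False by (auto simp: mem_box_cart field_simps)
    ultimately show ?thesis
      by blast
  qed
next
  fix x assume "x \<in> (\<lambda>u. a + s *\<^sub>R u) ` cbox 0 (vec 1)"
  then show "x \<in> cbox a (a + vec s)"
    using assms by (auto simp: mem_box_cart mult_left_le)
qed

lemma is_square_subset_side_le:
  assumes "is_square s Q" "Q \<subseteq> cball z r"
  shows "s \<le> 2 * r"
proof -
  obtain a where a: "Q = cbox a (a + vec s)" and "0 < s"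
    using assms by (auto simp: is_square_def)
  have "s = \<bar>(a + vec s - a) $ 1\<bar>"
    using \<open>0 < s\<close> by simp
  also have "\<dots> \<le> dist (a + vec s) a"
    unfolding dist_norm by (rule component_le_norm_cart)
  also have "\<dots> \<le> 2 * r"
  proof -
    have "a \<in> Q" "a + vec s \<in> Q"
      using a \<open>0 < s\<close> by (auto simp: mem_box_cart)
    then have "a \<in> cball z r" "a + vec s \<in> cball z r"
      using assms(2) by blast+
    then show ?thesis
      using dist_triangle2[of "a + vec s" a z] by (simp add: dist_commute)
  qed
  finally show ?thesis .
qed

text \<open>
  Degenerate squares of side \<open>0\<close> are admitted to make the set of pairs of a corner and a side closed;
  the nonempty interior then forces the maximal side to be positive.
\<close>

lemma max_square_side_attained:
  fixes K :: "(real^2) set"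
  assumes "compact K" and "interior K \<noteq> {}"
  shows "\<exists>Q. is_square (max_square_side K) Q \<and> Q \<subseteq> K"
    and "\<And>s Q. is_square s Q \<Longrightarrow> Q \<subseteq> K \<Longrightarrow> s \<le> max_square_side K"
proof -
  let ?P = "\<lambda>s. \<exists>Q. is_square s Q \<and> Q \<subseteq> K"
  obtain z r where K: "K \<subseteq> cball z r"
    using compact_imp_bounded[OF \<open>compact K\<close>] by (meson bounded_subset_cball)
  \<comment> \<open>The pairs \<open>(a, s)\<close> of a corner and a side with square in \<open>K\<close>.  Scaling the points \<open>u\<close> of the unit
     square turns the inclusion into one closed condition on \<open>(a, s)\<close> for each \<open>u\<close>.\<close>
  define D where "D = (K \<times> {0..2 * r}) \<inter> (\<Inter>u\<in>cbox 0 (vec 1). (\<lambda>p. fst p + snd p *\<^sub>R u) -` K)"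
  have "closed ((\<lambda>p::(real^2) \<times> real. fst p + snd p *\<^sub>R u) -` K)" for u
    using compact_imp_closed[OF \<open>compact K\<close>] by (intro closed_vimage continuous_intros) auto
  then have "compact D"
    unfolding D_def using \<open>compact K\<close>
    by (intro compact_Int_closed compact_Times closed_INT) auto
  have D_iff: "(a, s) \<in> D \<longleftrightarrow> cbox a (a + vec s) \<subseteq> K" if "0 < s" for a s
  proof
    assume "(a, s) \<in> D"
    then show "cbox a (a + vec s) \<subseteq> K"
      using that by (auto simp: D_def cbox_vec_eq_image)
  next
    assume sub: "cbox a (a + vec s) \<subseteq> K"
    have "a \<in> cbox a (a + vec s)"
      using that by (simp add: mem_box_cart)
    moreover have "s \<le> 2 * r"
      using that sub K
      by (intro is_square_subset_side_le[of s "cbox a (a + vec s)" z]) (auto simp: is_square_def)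
    ultimately show "(a, s) \<in> D"
      using that sub by (auto simp: D_def cbox_vec_eq_image)
  qed
  obtain w d where "0 < d" and d: "cball w d \<subseteq> K"
    using assms(2) by (meson ex_in_conv mem_interior_cball)
  have "square_around w (d / 2) \<subseteq> cball w d"
  proof
    fix x assume "x \<in> square_around w (d / 2)"
    then have "\<bar>(w - x) $ i\<bar> \<le> d / 2" for i
      by (simp add: mem_square_around abs_minus_commute)
    from add_mono[OF this[of 1] this[of 2]] have "(\<Sum>i\<in>UNIV. \<bar>(w - x) $ i\<bar>) \<le> d"
      unfolding UNIV_2 by simp
    then show "x \<in> cball w d"
      using norm_le_l1_cart[of "w - x"] by (simp add: dist_norm)
  qed
  then have "?P d"
    using is_square_square_around[of "d / 2" w] \<open>0 < d\<close> d by auto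
  then obtain a0 where a0: "(a0, d) \<in> D"
    using D_iff by (auto simp: is_square_def)
  have "continuous_on D snd"
    by (intro continuous_intros)
  then obtain p where p: "p \<in> D" "\<And>q. q \<in> D \<Longrightarrow> snd q \<le> snd p"
    using continuous_attains_sup[OF \<open>compact D\<close>] a0 by blast
  obtain a m where m: "p = (a, m)"
    by (cases p)
  have "0 < m"
    using p(2)[OF a0] \<open>0 < d\<close> m by simp
  then have Pm: "?P m"
    using p(1) m D_iff by (auto simp: is_square_def)
  have max: "s \<le> m" if "?P s" for s
    using that p(2) m D_iff by (fastforce simp: is_square_def)
  have "max_square_side K = m"
    unfolding max_square_side_def using Pm max by (rule Greatest_equality)
  then show "?P (max_square_side K)" "\<And>s Q. is_square s Q \<Longrightarrow> Q \<subseteq> K \<Longrightarrow> s \<le> max_square_side K"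
    using Pm max by auto
qed

section \<open>The perimeter-to-area inequality\<close>

theorem theorem3:
  "\<exists>C::real. C > 0 \<and>
     (\<forall>(\<Omega>::(real^2) set) (vs::(real^2) list).
        simple_polygon_with_boundary \<Omega> vs \<longrightarrow>
        polygonal_length vs / measure lebesgue \<Omega> \<ge> C * inverse (max_square_side \<Omega>))"
proof (intro exI[of _ "1 / 48"] conjI allI impI)
  fix \<Omega> :: "(real^2) set" and vs
  assume poly: "simple_polygon_with_boundary \<Omega> vs"
  define S where "S = path_image (polygonal_path vs)"
  define L where "L = polygonal_length vs"
  define \<epsilon> where "\<epsilon> = max_square_side \<Omega>"
  have simple: "simple_path (polygonal_path vs)"
    "pathfinish (polygonal_path vs) = pathstart (polygonal_path vs)"
    and \<Omega>: "\<Omega> = S \<union> inside S"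
    using poly by (auto simp: simple_polygon_with_boundary_def simple_closed_polygonal_def S_def)
  have path: "path (polygonal_path vs)"
    using simple(1) by (rule simple_path_imp_path)
  obtain g where g: "1-lipschitz_on {0..L} g" "S \<subseteq> g ` {0..L}"
    using unit_speed_polygonal_path unfolding L_def S_def by blast
  have "0 \<le> L"
    by (simp add: L_def polygonal_length_nonneg)

  have "S \<subseteq> cball (g 0) L"
    using g lipschitz_onD[OF g(1), of 0] \<open>0 \<le> L\<close> by (force simp: dist_real_def)
  moreover from this have "- cball (g 0) L \<subseteq> outside S"
    by (intro outside_subset_convex convex_cball)
  ultimately have \<Omega>_cball: "\<Omega> \<subseteq> cball (g 0) L"
    using inside_Int_outside[of S] unfolding \<Omega> by blast
  have "closed \<Omega>"
    using closed_path_image_Un_inside[OF path] by (simp add: \<Omega> S_def)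
  then have "compact \<Omega>"
    using \<Omega>_cball bounded_subset compact_eq_bounded_closed by blast
  have "open (inside S)"
    unfolding S_def by (intro open_inside closed_path_image path)
  moreover have "inside S \<noteq> {}"
    unfolding S_def by (intro inside_simple_closed_curve_nonempty simple)
  ultimately have interior: "interior \<Omega> \<noteq> {}"
    using interior_maximal[of "inside S" \<Omega>] by (auto simp: \<Omega>)
  obtain Q where Q: "is_square \<epsilon> Q" "Q \<subseteq> \<Omega>"
    using max_square_side_attained(1)[OF \<open>compact \<Omega>\<close> interior] unfolding \<epsilon>_def by blast
  have "0 < \<epsilon>"
    using Q(1) by (simp add: is_square_def)
  have "\<epsilon> \<le> 2 * L"
    using is_square_subset_side_le Q \<Omega>_cball by blast

  have "measure lebesgue \<Omega> \<le> 16 * \<epsilon> * (L + \<epsilon>)"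
  proof (rule measure_near_lipschitz_curve_le[OF g(1) \<open>0 \<le> L\<close> \<open>0 < \<epsilon>\<close>])
    show "\<Omega> \<in> sets lebesgue"
      using \<open>closed \<Omega>\<close> by simp
    fix x assume "x \<in> \<Omega>"
    have "\<not> square_around x \<epsilon> \<subseteq> \<Omega>"
      using max_square_side_attained(2)[OF \<open>compact \<Omega>\<close> interior is_square_square_around] \<open>0 < \<epsilon>\<close>
      unfolding \<epsilon>_def[symmetric] by fastforce
    moreover have "connected (square_around x \<epsilon>)"
      unfolding square_around_def by (intro convex_connected convex_box)
    moreover have "x \<in> square_around x \<epsilon>"
      using \<open>0 < \<epsilon>\<close> by (simp add: mem_square_around)
    ultimately obtain y where "y \<in> square_around x \<epsilon>" "y \<in> S"
      using connected_meets_boundary[of "square_around x \<epsilon>" x S] \<open>x \<in> \<Omega>\<close> unfolding \<Omega> by blast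
    then show "\<exists>t\<in>{0..L}. x \<in> square_around (g t) \<epsilon>"
      using g(2) by (force simp: mem_square_around abs_minus_commute)
  qed
  also have "\<dots> \<le> 16 * \<epsilon> * (3 * L)"
    using \<open>\<epsilon> \<le> 2 * L\<close> \<open>0 < \<epsilon>\<close> by (intro mult_left_mono) auto
  finally have area_le: "measure lebesgue \<Omega> \<le> 48 * \<epsilon> * L"
    by simp
  obtain a where a: "Q = cbox a (a + vec \<epsilon>)"
    using Q(1) by (auto simp: is_square_def)
  have "0 < measure lebesgue Q"
    using \<open>0 < \<epsilon>\<close> unfolding a
    by (subst measure_completion) (auto simp: content_cbox_if_cart UNIV_2 interval_eq_empty_cart)
  also have "\<dots> \<le> measure lebesgue \<Omega>"
    using Q(2) \<open>compact \<Omega>\<close> unfolding a by (intro measure_mono_fmeasurable lmeasurable_compact) auto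
  finally have "0 < measure lebesgue \<Omega>" .
  then show "polygonal_length vs / measure lebesgue \<Omega> \<ge> 1 / 48 * inverse (max_square_side \<Omega>)"
    using area_le \<open>0 < \<epsilon>\<close> unfolding L_def[symmetric] \<epsilon>_def[symmetric] by (simp add: field_simps)
qed simp

end
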